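(* Let $m\ge1$ and $\xi=\exp(2\pi\sqrt{-1}/m)$. Consider the change of variables $$p^{(\alpha)}_i=\sum_{\nu=0}^{m-1}\xi^{\alpha\nu}u^{(\nu)}_i\qquad(\alpha=0,\dots,m-1,\ i\ge1).$$ Then $$\mathcal{CJ}_0=m\left(\mathcal{CJ}_{u^{(0)}}+\dots+\mathcal{CJ}_{u^{(m-1)}}\right),\qquad \mathcal{CJ}_k=\sum_{\alpha=0}^{m-1}\xi^{k\alpha}E_{u^{(\alpha)}}\quad(k=1,\dots,m-1).$$
   Context: The variables are $p^{(\alpha)}_i$, $\alpha\in\mathbb{Z}/m\mathbb{Z}$, $i\ge1$. The cut-and-join operators of $G(m,1,n)$ are $$\mathcal{CJ}_0=\frac12\sum_{\substack{i,j\ge 1\\ \alpha,\gamma\in\mathbb{Z}/m\mathbb{Z}}}\left((i+j)\,p^{(\alpha)}_i p^{(\gamma)}_j\frac{\partial}{\partial p^{(\alpha+\gamma)}_{i+j}}+m\,ij\,p^{(\alpha+\gamma)}_{i+j}\frac{\partial^2}{\partial p^{(\alpha)}_i\,\partial p^{(\gamma)}_j}\right),$$ $$\mathcal{CJ}_k=\sum_{i\ge 1,\ \alpha\in\mathbb{Z}/m\mathbb{Z}} i\,p^{(\alpha+k)}_i\frac{\partial}{\partial p^{(\alpha)}_i}\qquad (k=1,\dots,m-1),$$ with upper indices modulo $m$. For a sequence of variables $q=(q_1,q_2,\dots)$ put $$\mathcal{CJ}_q=\frac12\sum_{i,j\ge1}\left(ij\,q_{i+j}\frac{\partial^2}{\partial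 q_i\partial q_j}+(i+j)q_iq_j\frac{\partial}{\partial q_{i+j}}\right),\qquad E_q=\sum_{i\ge1}i\,q_i\frac{\partial}{\partial q_i},$$ and $u^{(\alpha)}=(u^{(\alpha)}_1,u^{(\alpha)}_2,\dots)$. *)

theory Defs
  imports Complex_Main "HOL-Library.Poly_Mapping"
begin

text \<open>
  Polynomials over the complex numbers in a possibly infinite set of variables: finitely supported
  functions from monomials to coefficients, with the convolution product of Poly_Mapping.
\<close>

type_synonym 'v mpoly = "('v \<Rightarrow>\<^sub>0 nat) \<Rightarrow>\<^sub>0 complex"

definition Const :: "complex \<Rightarrow> 'v mpoly" where
  "Const c = Poly_Mapping.single 0 c"

definition Var :: "'v \<Rightarrow> 'v mpoly" where
  "Var v = Poly_Mapping.single (Poly_Mapping.single v 1) 1"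

definition vars :: "'v mpoly \<Rightarrow> 'v set" where
  "vars f = (\<Union>t\<in>Poly_Mapping.keys f. Poly_Mapping.keys t)"

definition polys_in :: "'v set \<Rightarrow> 'v mpoly set" where
  "polys_in V = {f. vars f \<subseteq> V}"

text \<open>
  In \<open>pdiff\<close>, monomials \<open>t\<close> not containing \<open>v\<close> contribute zero because of the factor
  \<open>lookup t v\<close>, so the truncated subtraction of exponents is harmless.
\<close>

definition pdiff :: "'v \<Rightarrow> 'v mpoly \<Rightarrow> 'v mpoly" where
  "pdiff v f = (\<Sum>t\<in>Poly_Mapping.keys f.
     Poly_Mapping.single (t - Poly_Mapping.single v 1)
       (of_nat (Poly_Mapping.lookup t v) * Poly_Mapping.lookup f t))"

definition psubst :: "('v \<Rightarrow> 'w mpoly) \<Rightarrow> 'v mpoly \<Rightarrow> 'w mpoly" where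
  "psubst \<sigma> f = (\<Sum>t\<in>Poly_Mapping.keys f.
     Const (Poly_Mapping.lookup f t) *
       (\<Prod>v\<in>Poly_Mapping.keys t. \<sigma> v ^ Poly_Mapping.lookup t v))"

text \<open>
  \<open>P \<alpha> i\<close> and \<open>U \<nu> i\<close> are the variables with upper index \<open>\<alpha>\<close>, resp. \<open>\<nu>\<close>, and lower index \<open>i\<close>.
  Residue classes modulo \<open>m\<close> are represented by \<open>{..<m}\<close>; only the variables in \<open>p_vars m\<close> and
  \<open>u_vars m\<close> are meaningful.
\<close>

datatype pvar = P nat nat
datatype uvar = U nat nat

definition p_vars :: "nat \<Rightarrow> pvar set" where
  "p_vars m = {P \<alpha> i | \<alpha> i. \<alpha> < m \<and> i \<ge> 1}"

definition u_vars :: "nat \<Rightarrow> uvar set" where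
  "u_vars m = {U \<nu> i | \<nu> i. \<nu> < m \<and> i \<ge> 1}"

text \<open>
  The differential operators act on polynomials. The library's \<open>sum'\<close> adds up the nonzero terms
  when there are finitely many of them; the \<open>finite_support\<close> lemmas below show that this is always
  the case here (for \<open>CJq\<close> and \<open>E_op\<close>, as soon as the variables \<open>q i\<close> are pairwise distinct).
\<close>

definition CJ0_term :: "nat \<Rightarrow> pvar mpoly \<Rightarrow> (nat \<times> nat) \<times> nat \<times> nat \<Rightarrow> pvar mpoly" where
  "CJ0_term m f = (\<lambda>((i, j), \<alpha>, \<gamma>).
     of_nat (i + j) * Var (P \<alpha> i) * Var (P \<gamma> j) * pdiff (P ((\<alpha> + \<gamma>) mod m) (i + j)) f
     + of_nat (m * i * j) * Var (P ((\<alpha> + \<gamma>) mod m) (i + j)) * pdiff (P \<alpha> i) (pdiff (P \<gamma> j) f))"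

definition CJ0 :: "nat \<Rightarrow> pvar mpoly \<Rightarrow> pvar mpoly" where
  "CJ0 m f = Const (1/2) * sum' (CJ0_term m f) (({1..} \<times> {1..}) \<times> ({..<m} \<times> {..<m}))"

definition CJk_term :: "nat \<Rightarrow> nat \<Rightarrow> pvar mpoly \<Rightarrow> nat \<times> nat \<Rightarrow> pvar mpoly" where
  "CJk_term m k f = (\<lambda>(i, \<alpha>).
     of_nat i * Var (P ((\<alpha> + k) mod m) i) * pdiff (P \<alpha> i) f)"

definition CJk :: "nat \<Rightarrow> nat \<Rightarrow> pvar mpoly \<Rightarrow> pvar mpoly" where
  "CJk m k f = sum' (CJk_term m k f) ({1..} \<times> {..<m})"

definition CJq_term :: "(nat \<Rightarrow> 'v) \<Rightarrow> 'v mpoly \<Rightarrow> nat \<times> nat \<Rightarrow> 'v mpoly" where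
  "CJq_term q f = (\<lambda>(i, j).
     of_nat (i * j) * Var (q (i + j)) * pdiff (q i) (pdiff (q j) f)
     + of_nat (i + j) * Var (q i) * Var (q j) * pdiff (q (i + j)) f)"

definition CJq :: "(nat \<Rightarrow> 'v) \<Rightarrow> 'v mpoly \<Rightarrow> 'v mpoly" where
  "CJq q f = Const (1/2) * sum' (CJq_term q f) ({1..} \<times> {1..})"

definition E_op_term :: "(nat \<Rightarrow> 'v) \<Rightarrow> 'v mpoly \<Rightarrow> nat \<Rightarrow> 'v mpoly" where
  "E_op_term q f = (\<lambda>i. of_nat i * Var (q i) * pdiff (q i) f)"

definition E_op :: "(nat \<Rightarrow> 'v) \<Rightarrow> 'v mpoly \<Rightarrow> 'v mpoly" where
  "E_op q f = sum' (E_op_term q f) {1..}"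

definition xi :: "nat \<Rightarrow> complex" where
  "xi m = exp (2 * of_real pi * \<i> / of_nat m)"

definition p_in_u :: "nat \<Rightarrow> pvar \<Rightarrow> uvar mpoly" where
  "p_in_u m v = (case v of P \<alpha> i \<Rightarrow> \<Sum>\<nu><m. Const (xi m ^ (\<alpha> * \<nu>)) * Var (U \<nu> i))"

definition change_vars :: "nat \<Rightarrow> pvar mpoly \<Rightarrow> uvar mpoly" where
  "change_vars m = psubst (p_in_u m)"

lemma finite_vars: "finite (vars f)"
  by (simp add: vars_def)

lemma pdiff_eq_0: "v \<notin> vars f \<Longrightarrow> pdiff v f = 0"
  unfolding pdiff_def vars_def
  by (intro sum.neutral) (auto simp: in_keys_iff)

lemma vars_pdiff: "vars (pdiff v f) \<subseteq> vars f"
proof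
  fix w assume "w \<in> vars (pdiff v f)"
  then obtain s where s: "s \<in> Poly_Mapping.keys (pdiff v f)" and w: "w \<in> Poly_Mapping.keys s"
    by (auto simp: vars_def)
  from s have "Poly_Mapping.lookup (pdiff v f) s \<noteq> 0" by (simp add: in_keys_iff)
  then obtain t where t: "t \<in> Poly_Mapping.keys f" "s = t - Poly_Mapping.single v 1"
    unfolding pdiff_def lookup_sum
    by (metis (no_types, lifting) lookup_single_not_eq sum.neutral)
  have "w \<in> Poly_Mapping.keys t" using w t by (auto simp: in_keys_iff lookup_minus)
  with t show "w \<in> vars f" by (auto simp: vars_def)
qed

lemma pdiff_pdiff_eq_0: "v \<notin> vars f \<or> w \<notin> vars f \<Longrightarrow> pdiff v (pdiff w f) = 0"
proof -
  assume a: "v \<notin> vars f \<or> w \<notin> vars f"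
  have "v \<notin> vars (pdiff w f)"
  proof (cases "w \<in> vars f")
    case True
    then show ?thesis using a vars_pdiff[of w f] by blast
  next
    case False
    then show ?thesis by (simp add: pdiff_eq_0 vars_def)
  qed
  then show ?thesis by (rule pdiff_eq_0)
qed

lemma finite_p_idx: "finite {i. \<exists>\<alpha>. P \<alpha> i \<in> vars f}"
proof -
  have "{i. \<exists>\<alpha>. P \<alpha> i \<in> vars f} \<subseteq> (\<lambda>v. case v of P \<alpha> i \<Rightarrow> i) ` vars f"
    by force
  then show ?thesis using finite_vars finite_surj by blast
qed

lemma CJ0_finite_support:
  "finite {x \<in> ({1..} \<times> {1..}) \<times> ({..<m} \<times> {..<m}). CJ0_term m f x \<noteq> 0}"
proof -
  obtain B where B: "\<And>\<alpha> i. P \<alpha> i \<in> vars f \<Longrightarrow> i \<le> B"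
    using finite_p_idx[of f] unfolding finite_nat_set_iff_bounded_le by blast
  have "{x \<in> ({1..} \<times> {1..}) \<times> ({..<m} \<times> {..<m}). CJ0_term m f x \<noteq> 0}
      \<subseteq> ({..B} \<times> {..B}) \<times> ({..<m} \<times> {..<m})"
  proof
    fix x assume "x \<in> {x \<in> ({1..} \<times> {1..}) \<times> ({..<m} \<times> {..<m}). CJ0_term m f x \<noteq> 0}"
    then obtain i j \<alpha> \<gamma> where x: "x = ((i, j), \<alpha>, \<gamma>)"
      and nz: "CJ0_term m f ((i, j), \<alpha>, \<gamma>) \<noteq> 0" and lt: "\<alpha> \<in> {..<m}" "\<gamma> \<in> {..<m}"
      by blast
    have "CJ0_term m f ((i, j), \<alpha>, \<gamma>) = 0"
      if "\<not> (P ((\<alpha> + \<gamma>) mod m) (i + j) \<in> vars f \<or> (P \<alpha> i \<in> vars f \<and> P \<gamma> j \<in> vars f))"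
      using that by (auto simp: CJ0_term_def pdiff_eq_0 pdiff_pdiff_eq_0)
    with nz have "P ((\<alpha> + \<gamma>) mod m) (i + j) \<in> vars f \<or> (P \<alpha> i \<in> vars f \<and> P \<gamma> j \<in> vars f)" by blast
    then have "i \<le> B \<and> j \<le> B" using B[of _ "i + j"] B[of \<alpha> i] B[of \<gamma> j] by force
    with lt show "x \<in> ({..B} \<times> {..B}) \<times> ({..<m} \<times> {..<m})" by (simp add: x)
  qed
  then show ?thesis by (rule finite_subset) simp
qed

lemma CJk_finite_support: "finite {x \<in> {1..} \<times> {..<m}. CJk_term m k f x \<noteq> 0}"
proof -
  have "{x \<in> {1..} \<times> {..<m}. CJk_term m k f x \<noteq> 0}
      \<subseteq> {i. \<exists>\<alpha>. P \<alpha> i \<in> vars f} \<times> {..<m}"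
  proof
    fix x assume "x \<in> {x \<in> {1..} \<times> {..<m}. CJk_term m k f x \<noteq> 0}"
    then obtain i \<alpha> where x: "x = (i, \<alpha>)"
      and nz: "CJk_term m k f (i, \<alpha>) \<noteq> 0" and lt: "\<alpha> \<in> {..<m}"
      by blast
    have "CJk_term m k f (i, \<alpha>) = 0" if "\<not> (P \<alpha> i \<in> vars f)"
      using that by (auto simp: CJk_term_def pdiff_eq_0 pdiff_pdiff_eq_0)
    with nz have "P \<alpha> i \<in> vars f" by blast
    with lt show "x \<in> {i. \<exists>\<alpha>. P \<alpha> i \<in> vars f} \<times> {..<m}" using x by blast
  qed
  then show ?thesis by (rule finite_subset) (simp add: finite_p_idx)
qed

lemma CJq_finite_support:
  assumes "inj_on q {1..}"
  shows "finite {x \<in> {1..} \<times> {1..}. CJq_term q f x \<noteq> 0}"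
proof -
  have "finite {i \<in> {1..}. q i \<in> vars f}"
    using finite_vars[of f] assms
    by (metis (no_types, lifting) finite_imageD finite_subset image_subsetI inj_on_subset
        mem_Collect_eq subsetI)
  then obtain B where B: "\<And>i. 1 \<le> i \<Longrightarrow> q i \<in> vars f \<Longrightarrow> i \<le> B"
    unfolding finite_nat_set_iff_bounded_le by auto
  have "{x \<in> {1..} \<times> {1..}. CJq_term q f x \<noteq> 0} \<subseteq> {..B} \<times> {..B}"
  proof
    fix x :: "nat \<times> nat"
    assume "x \<in> {x \<in> {1..} \<times> {1..}. CJq_term q f x \<noteq> 0}"
    then obtain i j where x: "x = (i, j)"
      and nz: "CJq_term q f (i, j) \<noteq> 0" and ge: "1 \<le> i" "1 \<le> j"
      by auto
    have "CJq_term q f (i, j) = 0" if "\<not> (q (i + j) \<in> vars f \<or> (q i \<in> vars f \<and> q j \<in> vars f))"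
      using that by (auto simp: CJq_term_def pdiff_eq_0 pdiff_pdiff_eq_0)
    with nz have "q (i + j) \<in> vars f \<or> (q i \<in> vars f \<and> q j \<in> vars f)" by blast
    then have "i \<le> B \<and> j \<le> B" using B[of "i + j"] B[of i] B[of j] ge by force
    then show "x \<in> {..B} \<times> {..B}" by (simp add: x)
  qed
  then show ?thesis by (rule finite_subset) simp
qed

lemma E_op_finite_support:
  assumes "inj_on q {1..}"
  shows "finite {i \<in> {1..}. E_op_term q f i \<noteq> 0}"
proof -
  have "finite {i \<in> {1..}. q i \<in> vars f}"
    using finite_vars[of f] assms
    by (metis (no_types, lifting) finite_imageD finite_subset image_subsetI inj_on_subset
        mem_Collect_eq subsetI)
  then show ?thesis
    by (rule finite_subset[rotated]) (use pdiff_eq_0 in \<open>fastforce simp: E_op_term_def\<close>)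
qed

end

theory Submission
  imports Defs
begin

text \<open>
  The substitution \<open>T\<close> defined by \<open>change_vars\<close> is a ring homomorphism, and at every lower index \<open>i\<close>
  it replaces the variables \<open>p\<close> by the discrete Fourier transform over the residues modulo \<open>m\<close> of the
  variables \<open>u\<close>. The chain rule says that derivatives transform by the same kernel,
  \<open>\<partial>(T f)/\<partial>u\<^sub>i\<^sup>\<nu> = (\<Sum>\<alpha>. \<xi>\<^sup>\<alpha>\<^sup>\<nu> T(\<partial>f/\<partial>p\<^sub>i\<^sup>\<alpha>))\<close>
  (\<open>pdiff_change_vars\<close>), because the kernel is symmetric in \<open>\<alpha>\<close> and \<open>\<nu>\<close>.

  The theorem thus becomes a statement about Fourier transforms for each fixed pair \<open>(i, j)\<close> or each
  fixed \<open>i\<close>. In the three kinds of terms, the upper indices enter as follows.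

  \<^item> In \<open>p\<^sup>\<alpha>\<^sup>+\<^sup>\<gamma> \<partial>\<^sup>2/\<partial>p\<^sup>\<alpha>\<partial>p\<^sup>\<gamma>\<close> the character value \<open>\<xi>\<^sup>(\<^sup>\<alpha>\<^sup>+\<^sup>\<gamma>\<^sup>)\<^sup>\<nu>\<close> of the first factor splits, and its two parts
    are consumed by the two derivatives: one common \<open>\<nu>\<close> remains (\<open>dft_join\<close>). The factor \<open>m\<close> of the result is
    the one in the definition of the operator.
  \<^item> In \<open>p\<^sup>\<alpha> p\<^sup>\<gamma> \<partial>/\<partial>p\<^sup>\<alpha>\<^sup>+\<^sup>\<gamma>\<close> the two factors carry independent upper indices after the transform, and the
    orthogonality of characters makes them equal (\<open>dft_cut\<close>). Here the factor \<open>m\<close> is the order of the group.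
  \<^item> In \<open>p\<^sup>\<alpha>\<^sup>+\<^sup>k \<partial>/\<partial>p\<^sup>\<alpha>\<close> the shift by \<open>k\<close> turns into multiplication by \<open>\<xi>\<^sup>k\<^sup>\<nu>\<close> (\<open>dft_add_index\<close>), and the transform
    moves from the variable to the derivative (\<open>sum_dft_mult\<close>).

  Bijectivity of the change of variables is Fourier inversion.
\<close>

section \<open>Polynomials as sums of monomials\<close>

lemma mpoly_monomial_induct [case_names single add]:
  fixes f :: "'v mpoly"
  assumes single: "\<And>t c. Q (Poly_Mapping.single t c)"
    and add: "\<And>f g. Q f \<Longrightarrow> Q g \<Longrightarrow> Q (f + g)"
  shows "Q f"
proof -
  have "f = (\<Sum>t\<in>Poly_Mapping.keys f. Poly_Mapping.single t (Poly_Mapping.lookup f t))"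
    by (rule poly_mapping_eqI) (simp add: lookup_sum lookup_single when_def in_keys_iff)
  moreover have "Q (\<Sum>t\<in>A. Poly_Mapping.single t (Poly_Mapping.lookup f t))" if "finite A" for A
    using that
  proof (induction A rule: finite_induct)
    case empty
    show ?case using single[of 0 0] by simp
  next
    case (insert t A)
    then show ?case by (simp add: single add)
  qed
  ultimately show ?thesis by (metis finite_keys)
qed

lemma Const_0 [simp]: "Const 0 = 0"
  by (simp add: Const_def)

lemma Const_1 [simp]: "Const 1 = 1"
  by (simp add: Const_def)

lemma Const_add: "Const (a + b) = Const a + Const b"
  by (simp add: Const_def single_add)

lemma Const_mult: "Const (a * b) = Const a * Const b"
  by (simp add: Const_def mult_single)

lemma Const_sum: "Const (sum g A) = (\<Sum>x\<in>A. Const (g x))"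
  by (induction A rule: infinite_finite_induct) (simp_all add: Const_add)

lemma of_nat_eq_Const: "of_nat n = Const (of_nat n)"
  by (induction n) (simp_all add: Const_add)

lemma Var_power: "Var v ^ n = Poly_Mapping.single (Poly_Mapping.single v n) 1"
  by (induction n) (simp_all add: Var_def mult_single single_add[symmetric] del: single_of_nat)

lemma single_eq_prod_Var:
  fixes t :: "'v \<Rightarrow>\<^sub>0 nat"
  shows "Poly_Mapping.single t c
     = Const c * (\<Prod>v\<in>Poly_Mapping.keys t. Var v ^ Poly_Mapping.lookup t v)"
proof -
  have t: "(\<Sum>v\<in>Poly_Mapping.keys t. Poly_Mapping.single v (Poly_Mapping.lookup t v)) = t"
    by (rule poly_mapping_eqI) (simp add: lookup_sum lookup_single when_def in_keys_iff)
  have "(\<Prod>v\<in>A. Poly_Mapping.single (s v) (1::complex)) = Poly_Mapping.single (\<Sum>v\<in>A. s v) 1"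
    for A and s :: "'v \<Rightarrow> 'v \<Rightarrow>\<^sub>0 nat"
    by (induction A rule: infinite_finite_induct) (simp_all add: mult_single)
  then have "(\<Prod>v\<in>Poly_Mapping.keys t. Var v ^ Poly_Mapping.lookup t v) = Poly_Mapping.single t 1"
    unfolding Var_power by (simp only: t)
  then show ?thesis by (simp add: Const_def mult_single)
qed

text \<open>
  Since only variables from \<open>V\<close> have to be treated, an identity between ring homomorphisms or
  derivations that holds on the variables in \<open>V\<close> extends to all polynomials in them. The identities
  below hold only for variables with upper index less than \<open>m\<close> and positive lower index.
\<close>

lemma polys_in_induct [consumes 1, case_names Const Var add mult]:
  assumes f: "f \<in> polys_in V"
    and Const: "\<And>c. Q (Const c)"
    and Var: "\<And>v. v \<in> V \<Longrightarrow> Q (Var v)"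
    and add: "\<And>f g. Q f \<Longrightarrow> Q g \<Longrightarrow> Q (f + g)"
    and mult: "\<And>f g. Q f \<Longrightarrow> Q g \<Longrightarrow> Q (f * g)"
  shows "Q f"
proof -
  have pow: "Q (Var v ^ n)" if "v \<in> V" for v n
    using that Const[of 1] by (induction n) (simp_all add: Var mult)
  have prod: "Q (\<Prod>v\<in>A. Var v ^ e v)" if "A \<subseteq> V" for A e
    using that Const[of 1] by (induction A rule: infinite_finite_induct) (simp_all add: pow mult)
  have sum: "Q (\<Sum>t\<in>A. g t)" if "\<And>t. t \<in> A \<Longrightarrow> Q (g t)" for A and g :: "_ \<Rightarrow> 'a mpoly"
    using that Const[of 0] by (induction A rule: infinite_finite_induct) (simp_all add: add)
  have "f = (\<Sum>t\<in>Poly_Mapping.keys f. Poly_Mapping.single t (Poly_Mapping.lookup f t))"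
    by (rule poly_mapping_eqI) (simp add: lookup_sum lookup_single when_def in_keys_iff)
  also have "Q \<dots>"
  proof (rule sum)
    fix t assume "t \<in> Poly_Mapping.keys f"
    then have "Poly_Mapping.keys t \<subseteq> V"
      using f by (auto simp: polys_in_def vars_def)
    then show "Q (Poly_Mapping.single t (Poly_Mapping.lookup f t))"
      by (subst single_eq_prod_Var) (intro mult Const prod)
  qed
  finally show ?thesis .
qed

lemma Const_in_polys_in: "Const c \<in> polys_in V"
  by (simp add: polys_in_def vars_def Const_def)

lemma Var_in_polys_in: "v \<in> V \<Longrightarrow> Var v \<in> polys_in V"
  by (simp add: polys_in_def vars_def Var_def)

lemma add_in_polys_in: "f \<in> polys_in V \<Longrightarrow> g \<in> polys_in V \<Longrightarrow> f + g \<in> polys_in V"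
  using keys_add[of f g] unfolding polys_in_def vars_def mem_Collect_eq by blast

lemma sum_in_polys_in: "(\<And>x. x \<in> A \<Longrightarrow> g x \<in> polys_in V) \<Longrightarrow> sum g A \<in> polys_in V"
  using Const_in_polys_in[of 0 V]
  by (induction A rule: infinite_finite_induct) (simp_all add: add_in_polys_in)

lemma mult_in_polys_in:
  assumes "f \<in> polys_in V" "g \<in> polys_in V"
  shows "f * g \<in> polys_in V"
  unfolding polys_in_def vars_def
proof safe
  fix t v assume t: "t \<in> Poly_Mapping.keys (f * g)" and v: "v \<in> Poly_Mapping.keys t"
  obtain r s where "t = r + s" "r \<in> Poly_Mapping.keys f" "s \<in> Poly_Mapping.keys g"
    using t keys_mult[of f g] by blast
  then show "v \<in> V"
    using v keys_add[of r s] assms unfolding polys_in_def vars_def mem_Collect_eq by blast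
qed

lemma pdiff_in_polys_in: "f \<in> polys_in V \<Longrightarrow> pdiff v f \<in> polys_in V"
  using vars_pdiff[of v f] by (auto simp: polys_in_def)


section \<open>Substitution is a ring homomorphism\<close>

text \<open>
  A common finite set of monomials lets the sums for \<open>f\<close>, \<open>g\<close> and \<open>f + g\<close> be compared term by term,
  although cancellation may make the support of \<open>f + g\<close> smaller.
\<close>

lemma psubst_superset:
  assumes "finite K" "Poly_Mapping.keys f \<subseteq> K"
  shows "psubst \<sigma> f = (\<Sum>t\<in>K. Const (Poly_Mapping.lookup f t) *
           (\<Prod>v\<in>Poly_Mapping.keys t. \<sigma> v ^ Poly_Mapping.lookup t v))"
  unfolding psubst_def using assms by (intro sum.mono_neutral_left) (auto simp: in_keys_iff)

lemma psubst_add: "psubst \<sigma> (f + g) = psubst \<sigma> f + psubst \<sigma> g"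
proof -
  let ?K = "Poly_Mapping.keys f \<union> Poly_Mapping.keys g"
  have "psubst \<sigma> h = (\<Sum>t\<in>?K. Const (Poly_Mapping.lookup h t) *
          (\<Prod>v\<in>Poly_Mapping.keys t. \<sigma> v ^ Poly_Mapping.lookup t v))"
    if "Poly_Mapping.keys h \<subseteq> ?K" for h
    using that by (intro psubst_superset) auto
  from this[of f] this[of g] this[OF keys_add] show ?thesis
    by (simp add: lookup_add Const_add distrib_right sum.distrib)
qed

lemma psubst_single:
  "psubst \<sigma> (Poly_Mapping.single t c)
     = Const c * (\<Prod>v\<in>Poly_Mapping.keys t. \<sigma> v ^ Poly_Mapping.lookup t v)"
  by (subst psubst_superset[of "{t}"]) auto

lemma psubst_mult: "psubst \<sigma> (f * g) = psubst \<sigma> f * psubst \<sigma> g"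
proof (induction f rule: mpoly_monomial_induct)
  case (single s a)
  show ?case
  proof (induction g rule: mpoly_monomial_induct)
    case (single t b)
    let ?K = "Poly_Mapping.keys s \<union> Poly_Mapping.keys t"
    have "(\<Prod>v\<in>Poly_Mapping.keys r. \<sigma> v ^ Poly_Mapping.lookup r v)
        = (\<Prod>v\<in>?K. \<sigma> v ^ Poly_Mapping.lookup r v)" if "Poly_Mapping.keys r \<subseteq> ?K" for r
      using that by (intro prod.mono_neutral_left) (auto simp: in_keys_iff)
    from this[of s] this[of t] this[OF keys_add] show ?case
      by (simp add: mult_single psubst_single lookup_add power_add prod.distrib Const_mult mult_ac)
  next
    case (add f g)
    then show ?case by (simp add: distrib_left psubst_add)
  qed
next
  case (add f g)
  then show ?case by (simp add: distrib_right psubst_add)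
qed

lemma psubst_Const [simp]: "psubst \<sigma> (Const c) = Const c"
  by (subst Const_def) (simp add: psubst_single)

lemma psubst_Var [simp]: "psubst \<sigma> (Var v) = \<sigma> v"
  by (simp add: Var_def psubst_single)

lemma psubst_of_nat [simp]: "psubst \<sigma> (of_nat n) = of_nat n"
  by (simp add: of_nat_eq_Const)

lemma psubst_sum: "psubst \<sigma> (sum g A) = (\<Sum>x\<in>A. psubst \<sigma> (g x))"
  using psubst_Const[of \<sigma> 0]
  by (induction A rule: infinite_finite_induct) (simp_all add: psubst_add)

lemma psubst_in_polys_in:
  assumes "f \<in> polys_in V" "\<And>v. v \<in> V \<Longrightarrow> \<sigma> v \<in> polys_in W"
  shows "psubst \<sigma> f \<in> polys_in W"
  using assms(1)
  by (induction rule: polys_in_induct)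
     (simp_all add: assms(2) Const_in_polys_in psubst_add psubst_mult add_in_polys_in mult_in_polys_in)

lemma psubst_psubst_id:
  assumes "f \<in> polys_in V" "\<And>v. v \<in> V \<Longrightarrow> psubst \<tau> (\<sigma> v) = Var v"
  shows "psubst \<tau> (psubst \<sigma> f) = f"
  using assms(1)
  by (induction rule: polys_in_induct) (simp_all add: assms(2) psubst_add psubst_mult)


section \<open>Partial derivatives and the chain rule\<close>

lemma pdiff_superset:
  assumes "finite K" "Poly_Mapping.keys f \<subseteq> K"
  shows "pdiff v f = (\<Sum>t\<in>K. Poly_Mapping.single (t - Poly_Mapping.single v 1)
           (of_nat (Poly_Mapping.lookup t v) * Poly_Mapping.lookup f t))"
  unfolding pdiff_def using assms by (intro sum.mono_neutral_left) (auto simp: in_keys_iff)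

lemma pdiff_add: "pdiff v (f + g) = pdiff v f + pdiff v g"
proof -
  let ?K = "Poly_Mapping.keys f \<union> Poly_Mapping.keys g"
  have "pdiff v h = (\<Sum>t\<in>?K. Poly_Mapping.single (t - Poly_Mapping.single v 1)
           (of_nat (Poly_Mapping.lookup t v) * Poly_Mapping.lookup h t))"
    if "Poly_Mapping.keys h \<subseteq> ?K" for h
    using that by (intro pdiff_superset) auto
  from this[of f] this[of g] this[OF keys_add] show ?thesis
    by (simp add: lookup_add distrib_left single_add sum.distrib)
qed

lemma pdiff_single:
  "pdiff v (Poly_Mapping.single t c)
     = Poly_Mapping.single (t - Poly_Mapping.single v 1) (of_nat (Poly_Mapping.lookup t v) * c)"
  by (subst pdiff_superset[of "{t}"]) auto

lemma pdiff_Const [simp]: "pdiff v (Const c) = 0"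
  by (simp add: Const_def pdiff_single)

lemma pdiff_Var: "pdiff v (Var w) = (if v = w then 1 else 0)"
  by (simp add: Var_def pdiff_single lookup_single when_def)

lemma pdiff_sum: "pdiff v (sum g A) = (\<Sum>x\<in>A. pdiff v (g x))"
  using pdiff_Const[of v 0]
  by (induction A rule: infinite_finite_induct) (simp_all add: pdiff_add)

text \<open>
  Subtraction of exponents is truncated and may fail to commute with addition when \<open>v\<close> does not
  occur in \<open>s\<close>; but such a monomial is annihilated by \<open>pdiff v\<close>.
\<close>

lemma minus_single_add:
  fixes s t :: "'v \<Rightarrow>\<^sub>0 nat"
  assumes "Poly_Mapping.lookup s v \<noteq> 0"
  shows "s + t - Poly_Mapping.single v 1 = s - Poly_Mapping.single v 1 + t"
proof (rule poly_mapping_eqI)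
  fix w
  show "Poly_Mapping.lookup (s + t - Poly_Mapping.single v 1) w
      = Poly_Mapping.lookup (s - Poly_Mapping.single v 1 + t) w"
    using assms by (cases "w = v") (auto simp: lookup_add lookup_minus lookup_single when_def)
qed

lemma pdiff_mult: "pdiff v (f * g) = pdiff v f * g + f * pdiff v g"
proof (induction f rule: mpoly_monomial_induct)
  case (single s a)
  show ?case
  proof (induction g rule: mpoly_monomial_induct)
    case (single t b)
    let ?e = "Poly_Mapping.single v 1"
    let ?n = "of_nat (Poly_Mapping.lookup s v) :: complex"
    let ?k = "of_nat (Poly_Mapping.lookup t v) :: complex"
    have "Poly_Mapping.single (s + t - ?e) (?n * a * b) = Poly_Mapping.single (s - ?e + t) (?n * a * b)"
      using minus_single_add[of s v t] by (cases "Poly_Mapping.lookup s v = 0") simp_all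
    moreover have "Poly_Mapping.single (s + t - ?e) (a * (?k * b))
        = Poly_Mapping.single (s + (t - ?e)) (a * (?k * b))"
      using minus_single_add[of t v s]
      by (cases "Poly_Mapping.lookup t v = 0") (simp_all add: add.commute)
    moreover have "(?n + ?k) * (a * b) = ?n * a * b + a * (?k * b)"
      by (simp add: algebra_simps)
    ultimately show ?case
      by (simp add: mult_single pdiff_single lookup_add single_add)
  next
    case (add f g)
    then show ?case by (simp add: distrib_left pdiff_add add_ac)
  qed
next
  case (add f g)
  then show ?case by (simp add: distrib_right pdiff_add add_ac)
qed

lemma pdiff_Const_mult: "pdiff v (Const c * f) = Const c * pdiff v f"
  by (simp add: pdiff_mult)

text \<open>
  Chain rule. The finite set \<open>S\<close> collects those variables whose images can involve \<open>w\<close>; it keeps the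
  sum finite and independent of \<open>f\<close> although \<open>V\<close> may be infinite. Both sides are derivations along
  the homomorphism \<open>psubst \<sigma>\<close>, so that it suffices to compare them on variables.
\<close>

lemma pdiff_psubst:
  assumes "f \<in> polys_in V" "finite S" "S \<subseteq> V"
    and "\<And>v. v \<in> V - S \<Longrightarrow> pdiff w (\<sigma> v) = 0"
  shows "pdiff w (psubst \<sigma> f) = (\<Sum>v\<in>S. pdiff w (\<sigma> v) * psubst \<sigma> (pdiff v f))"
  using assms(1)
proof (induction rule: polys_in_induct)
  case (Const c)
  show ?case using psubst_Const[of \<sigma> 0] by simp
next
  case (Var u)
  have "(\<Sum>v\<in>S. pdiff w (\<sigma> v) * psubst \<sigma> (pdiff v (Var u)))
      = (\<Sum>v\<in>S. if v = u then pdiff w (\<sigma> u) else 0)"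
    using psubst_Const[of \<sigma> 0] psubst_Const[of \<sigma> 1] by (intro sum.cong) (auto simp: pdiff_Var)
  also have "\<dots> = pdiff w (\<sigma> u)" using assms(2,4) Var by simp
  finally show ?case by simp
next
  case (add f g)
  then show ?case by (simp add: psubst_add pdiff_add distrib_left sum.distrib)
next
  case (mult f g)
  then show ?case
    by (simp add: psubst_mult psubst_add pdiff_mult pdiff_add distrib_left sum.distrib
        sum_distrib_left sum_distrib_right mult_ac)
qed


section \<open>The discrete Fourier transform on the residues modulo m\<close>

definition dft :: "nat \<Rightarrow> (nat \<Rightarrow> 'v mpoly) \<Rightarrow> nat \<Rightarrow> 'v mpoly" where
  "dft m a \<alpha> = (\<Sum>\<nu><m. Const (xi m ^ (\<alpha> * \<nu>)) * a \<nu>)"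

lemma xi_nonzero [simp]: "xi m \<noteq> 0"
  by (simp add: xi_def)

lemma xi_power_m: "m \<ge> 1 \<Longrightarrow> xi m ^ m = 1"
  by (simp add: xi_def exp_of_nat_mult[symmetric])

text \<open>
  This makes the characters well defined on residue classes and so justifies replacing
  \<open>(\<alpha> + \<gamma>) mod m\<close> by \<open>\<alpha> + \<gamma>\<close> in exponents.
\<close>

lemma xi_power_cong:
  assumes "m \<ge> 1"
  shows "xi m ^ ((n mod m) * \<nu>) = xi m ^ (n * \<nu>)"
proof -
  have "xi m ^ n = xi m ^ (m * (n div m) + n mod m)" by simp
  also have "\<dots> = xi m ^ (n mod m)"
    unfolding power_add power_mult by (simp add: xi_power_m[OF assms])
  finally show ?thesis by (simp add: power_mult)
qed

lemma xi_power_inj: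
  assumes "\<nu> < m" "\<mu> < m" "xi m ^ \<nu> = xi m ^ \<mu>"
  shows "\<nu> = \<mu>"
proof -
  have cis: "xi m ^ k = cis (2 * pi * real k / real m)" for k
    by (simp add: xi_def exp_of_nat_mult[symmetric] cis_conv_exp mult_ac)
  have "inj_on (\<lambda>k. cis (2 * pi * real k / real m)) {..<m}"
    using bij_betw_roots_unity[of m] assms by (auto simp: bij_betw_def)
  then show ?thesis using assms by (auto simp: cis inj_on_def)
qed

text \<open>
  Orthogonality of characters: the sum is geometric with ratio \<open>\<xi>\<^sup>\<nu>\<^sup>-\<^sup>\<mu>\<close>, an \<open>m\<close>-th root of unity that
  differs from \<open>1\<close> unless \<open>\<nu> = \<mu>\<close>.
\<close>

lemma sum_characters:
  assumes "\<nu> < m" "\<mu> < m"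
  shows "(\<Sum>\<alpha><m. inverse (xi m) ^ (\<alpha> * \<mu>) * xi m ^ (\<alpha> * \<nu>)) = (if \<nu> = \<mu> then of_nat m else 0)"
proof -
  let ?z = "inverse (xi m) ^ \<mu> * xi m ^ \<nu>"
  have "(\<Sum>\<alpha><m. inverse (xi m) ^ (\<alpha> * \<mu>) * xi m ^ (\<alpha> * \<nu>)) = (\<Sum>\<alpha><m. ?z ^ \<alpha>)"
    by (intro sum.cong) (simp_all add: power_mult_distrib power_mult[symmetric] mult.commute)
  also have "\<dots> = (if \<nu> = \<mu> then of_nat m else 0)"
  proof (cases "\<nu> = \<mu>")
    case True
    then have "?z = 1" by (simp add: power_inverse)
    then show ?thesis using True by simp
  next
    case False
    then have "?z \<noteq> 1"
      using xi_power_inj[OF assms] by (auto simp: power_inverse field_simps)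
    moreover have "?z ^ m = (inverse (xi m) ^ m) ^ \<mu> * (xi m ^ m) ^ \<nu>"
      by (simp add: power_mult_distrib power_mult[symmetric] mult.commute)
    then have "?z ^ m = 1" using assms by (simp add: power_inverse xi_power_m)
    ultimately show ?thesis using False by (simp add: geometric_sum)
  qed
  finally show ?thesis .
qed

lemma dft_inverse:
  assumes "\<mu> < m"
  shows "(\<Sum>\<alpha><m. Const (inverse (xi m) ^ (\<alpha> * \<mu>)) * dft m a \<alpha>) = of_nat m * a \<mu>"
proof -
  have "(\<Sum>\<alpha><m. Const (inverse (xi m) ^ (\<alpha> * \<mu>)) * dft m a \<alpha>)
      = (\<Sum>\<alpha><m. \<Sum>\<nu><m. Const (inverse (xi m) ^ (\<alpha> * \<mu>) * xi m ^ (\<alpha> * \<nu>)) * a \<nu>)"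
    by (simp add: dft_def sum_distrib_left Const_mult mult.assoc)
  also have "\<dots> = (\<Sum>\<nu><m. Const (\<Sum>\<alpha><m. inverse (xi m) ^ (\<alpha> * \<mu>) * xi m ^ (\<alpha> * \<nu>)) * a \<nu>)"
    by (subst sum.swap) (simp add: Const_sum sum_distrib_right)
  also have "\<dots> = (\<Sum>\<nu><m. if \<nu> = \<mu> then of_nat m * a \<mu> else 0)"
    using assms by (intro sum.cong) (auto simp: sum_characters of_nat_eq_Const)
  finally show ?thesis using assms by simp
qed

lemma dft_of_inverse:
  assumes "\<alpha> < m"
  shows "dft m (\<lambda>\<nu>. Const (1 / of_nat m) * (\<Sum>\<beta><m. Const (inverse (xi m) ^ (\<beta> * \<nu>)) * b \<beta>)) \<alpha>
       = b \<alpha>"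
proof -
  let ?c = "\<lambda>\<beta>. \<Sum>\<nu><m. inverse (xi m) ^ (\<nu> * \<beta>) * xi m ^ (\<nu> * \<alpha>)"
  have "dft m (\<lambda>\<nu>. Const (1 / of_nat m) * (\<Sum>\<beta><m. Const (inverse (xi m) ^ (\<beta> * \<nu>)) * b \<beta>)) \<alpha>
      = (\<Sum>\<nu><m. \<Sum>\<beta><m. Const (1 / of_nat m)
          * Const (inverse (xi m) ^ (\<nu> * \<beta>) * xi m ^ (\<nu> * \<alpha>)) * b \<beta>)"
    by (simp add: dft_def sum_distrib_left Const_mult mult_ac)
  also have "\<dots> = (\<Sum>\<beta><m. Const (1 / of_nat m * ?c \<beta>) * b \<beta>)"
    by (subst sum.swap)
       (simp only: Const_mult Const_sum sum_distrib_left sum_distrib_right mult.assoc)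
  also have "\<dots> = (\<Sum>\<beta><m. if \<beta> = \<alpha> then b \<alpha> else 0)"
    using assms by (intro sum.cong) (auto simp: sum_characters)
  finally show ?thesis using assms by simp
qed

text \<open>
  Translating the index of the transform multiplies its argument by a character. For \<open>\<gamma> = k\<close> this
  produces the coefficients \<open>\<xi>\<^sup>k\<^sup>\<nu>\<close> of the Euler operators.
\<close>

lemma dft_add_index:
  assumes "m \<ge> 1"
  shows "dft m a ((\<alpha> + \<gamma>) mod m) = dft m (\<lambda>\<nu>. Const (xi m ^ (\<gamma> * \<nu>)) * a \<nu>) \<alpha>"
  by (simp add: dft_def xi_power_cong[OF assms] distrib_right power_add Const_mult mult.assoc)

text \<open>
  Dual to the previous lemma, translating the argument multiplies the transform by a character:
  \<open>\<gamma> \<mapsto> \<alpha> + \<gamma>\<close> permutes the residue classes.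
\<close>

lemma dft_shift:
  assumes "m \<ge> 1"
  shows "dft m (\<lambda>\<gamma>. d ((\<alpha> + \<gamma>) mod m)) \<mu> = Const (inverse (xi m) ^ (\<alpha> * \<mu>)) * dft m d \<mu>"
proof -
  have bij: "bij_betw (\<lambda>\<gamma>. (\<alpha> + \<gamma>) mod m) {..<m} {..<m}"
  proof (rule bij_betw_byWitness[where f' = "\<lambda>\<beta>. (\<beta> + (m - \<alpha> mod m)) mod m"])
    have le: "\<alpha> mod m \<le> m" using assms by (simp add: less_imp_le)
    show "\<forall>\<gamma>\<in>{..<m}. ((\<alpha> + \<gamma>) mod m + (m - \<alpha> mod m)) mod m = \<gamma>"
    proof
      fix \<gamma> assume "\<gamma> \<in> {..<m}"
      have "((\<alpha> + \<gamma>) mod m + (m - \<alpha> mod m)) mod m = (\<gamma> + (\<alpha> mod m + (m - \<alpha> mod m))) mod m"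
        by (metis (no_types, lifting) add.assoc add.commute mod_add_left_eq)
      then show "((\<alpha> + \<gamma>) mod m + (m - \<alpha> mod m)) mod m = \<gamma>"
        using le \<open>\<gamma> \<in> {..<m}\<close> by simp
    qed
    show "\<forall>\<beta>\<in>{..<m}. (\<alpha> + (\<beta> + (m - \<alpha> mod m)) mod m) mod m = \<beta>"
    proof
      fix \<beta> assume "\<beta> \<in> {..<m}"
      have "(\<alpha> + (\<beta> + (m - \<alpha> mod m)) mod m) mod m = (\<beta> + (\<alpha> mod m + (m - \<alpha> mod m))) mod m"
        by (metis (no_types, lifting) add.assoc add.commute mod_add_left_eq)
      then show "(\<alpha> + (\<beta> + (m - \<alpha> mod m)) mod m) mod m = \<beta>"
        using le \<open>\<beta> \<in> {..<m}\<close> by simp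
    qed
  qed (use assms in auto)
  have shift: "inverse (xi m) ^ (\<alpha> * \<mu>) * xi m ^ ((\<alpha> + \<gamma>) mod m * \<mu>) = xi m ^ (\<gamma> * \<mu>)" for \<gamma>
    by (simp add: xi_power_cong[OF assms] distrib_right power_add power_inverse)
  have "Const (inverse (xi m) ^ (\<alpha> * \<mu>)) * dft m d \<mu>
      = (\<Sum>\<beta><m. Const (inverse (xi m) ^ (\<alpha> * \<mu>) * xi m ^ (\<beta> * \<mu>)) * d \<beta>)"
    by (simp add: dft_def sum_distrib_left Const_mult mult_ac)
  also have "\<dots> = (\<Sum>\<gamma><m. Const (inverse (xi m) ^ (\<alpha> * \<mu>) * xi m ^ ((\<alpha> + \<gamma>) mod m * \<mu>))
      * d ((\<alpha> + \<gamma>) mod m))"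
    using sum.reindex_bij_betw[OF bij] by (rule sym)
  also have "\<dots> = dft m (\<lambda>\<gamma>. d ((\<alpha> + \<gamma>) mod m)) \<mu>"
    by (simp only: shift dft_def mult.commute[of \<mu>])
  finally show ?thesis by simp
qed

text \<open>The kernel \<open>\<xi>\<^sup>\<gamma>\<^sup>\<mu>\<close> is symmetric, hence the transform is self-adjoint for this pairing.\<close>

lemma sum_dft_mult: "(\<Sum>\<gamma><m. dft m b \<gamma> * d \<gamma>) = (\<Sum>\<mu><m. b \<mu> * dft m d \<mu>)"
proof -
  have "(\<Sum>\<gamma><m. dft m b \<gamma> * d \<gamma>) = (\<Sum>\<gamma><m. \<Sum>\<mu><m. Const (xi m ^ (\<gamma> * \<mu>)) * b \<mu> * d \<gamma>)"
    by (simp add: dft_def sum_distrib_right)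
  also have "\<dots> = (\<Sum>\<mu><m. b \<mu> * dft m d \<mu>)"
    by (subst sum.swap) (simp add: dft_def sum_distrib_left mult_ac)
  finally show ?thesis .
qed

text \<open>
  For fixed \<open>\<alpha>\<close>, self-adjointness and the translation rule turn the inner sum into
  \<open>\<Sum>\<mu>. \<xi>\<^sup>-\<^sup>\<alpha>\<^sup>\<mu> b\<^sub>\<mu> (dft d)\<^sub>\<mu>\<close>. The sum over \<open>\<alpha>\<close> then inverts the transform of \<open>a\<close> at \<open>\<mu>\<close>, which forces both
  factors to have the same index and yields the factor \<open>m\<close>.
\<close>

lemma dft_cut:
  assumes "m \<ge> 1"
  shows "(\<Sum>\<alpha><m. \<Sum>\<gamma><m. dft m a \<alpha> * dft m b \<gamma> * d ((\<alpha> + \<gamma>) mod m))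
       = of_nat m * (\<Sum>\<nu><m. a \<nu> * b \<nu> * dft m d \<nu>)"
proof -
  have "(\<Sum>\<alpha><m. \<Sum>\<gamma><m. dft m a \<alpha> * dft m b \<gamma> * d ((\<alpha> + \<gamma>) mod m))
      = (\<Sum>\<alpha><m. dft m a \<alpha> * (\<Sum>\<gamma><m. dft m b \<gamma> * d ((\<alpha> + \<gamma>) mod m)))"
    by (simp add: sum_distrib_left mult.assoc)
  also have "\<dots> = (\<Sum>\<alpha><m. \<Sum>\<mu><m. b \<mu> * dft m d \<mu> * (Const (inverse (xi m) ^ (\<alpha> * \<mu>)) * dft m a \<alpha>))"
    by (simp add: sum_dft_mult dft_shift[OF assms] sum_distrib_left mult_ac)
  also have "\<dots> = (\<Sum>\<mu><m. b \<mu> * dft m d \<mu> * (\<Sum>\<alpha><m. Const (inverse (xi m) ^ (\<alpha> * \<mu>)) * dft m a \<alpha>))"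
    by (subst sum.swap) (simp add: sum_distrib_left)
  also have "\<dots> = (\<Sum>\<mu><m. b \<mu> * dft m d \<mu> * (of_nat m * a \<mu>))"
    by (intro sum.cong refl arg_cong[where f = "(*) _"] dft_inverse) simp
  also have "\<dots> = of_nat m * (\<Sum>\<nu><m. a \<nu> * b \<nu> * dft m d \<nu>)"
    by (simp add: sum_distrib_left mult_ac)
  finally show ?thesis .
qed

text \<open>
  The translation rule moves \<open>\<xi>\<^sup>\<gamma>\<^sup>\<nu>\<close> onto \<open>a\<close>, self-adjointness then transforms \<open>d\<close> in \<open>\<alpha>\<close>, and the factor
  \<open>\<xi>\<^sup>\<gamma>\<^sup>\<nu>\<close> transforms it in \<open>\<gamma>\<close>, at the same frequency \<open>\<nu>\<close>.
\<close>

lemma dft_join: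
  assumes "m \<ge> 1"
  shows "(\<Sum>\<alpha><m. \<Sum>\<gamma><m. dft m a ((\<alpha> + \<gamma>) mod m) * d \<alpha> \<gamma>)
       = (\<Sum>\<nu><m. a \<nu> * dft m (\<lambda>\<gamma>. dft m (\<lambda>\<alpha>. d \<alpha> \<gamma>) \<nu>) \<nu>)"
proof -
  have "(\<Sum>\<alpha><m. \<Sum>\<gamma><m. dft m a ((\<alpha> + \<gamma>) mod m) * d \<alpha> \<gamma>)
      = (\<Sum>\<gamma><m. \<Sum>\<alpha><m. dft m (\<lambda>\<nu>. Const (xi m ^ (\<gamma> * \<nu>)) * a \<nu>) \<alpha> * d \<alpha> \<gamma>)"
    by (subst sum.swap) (simp add: dft_add_index[OF assms])
  also have "\<dots> = (\<Sum>\<gamma><m. \<Sum>\<nu><m. Const (xi m ^ (\<gamma> * \<nu>)) * a \<nu> * dft m (\<lambda>\<alpha>. d \<alpha> \<gamma>) \<nu>)"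
    by (simp add: sum_dft_mult)
  also have "\<dots> = (\<Sum>\<nu><m. a \<nu> * dft m (\<lambda>\<gamma>. dft m (\<lambda>\<alpha>. d \<alpha> \<gamma>) \<nu>) \<nu>)"
    unfolding dft_def[of m "\<lambda>\<gamma>. dft m (\<lambda>\<alpha>. d \<alpha> \<gamma>) _"]
    by (subst sum.swap) (simp add: sum_distrib_left mult_ac)
  finally show ?thesis .
qed


section \<open>The change of variables\<close>

lemma p_in_u_P: "p_in_u m (P \<alpha> i) = dft m (\<lambda>\<nu>. Var (U \<nu> i)) \<alpha>"
  by (simp add: p_in_u_def dft_def)

text \<open>The inverse Fourier transform of the variables \<open>p\<close> with lower index \<open>i\<close>.\<close>

definition u_in_p :: "nat \<Rightarrow> uvar \<Rightarrow> pvar mpoly" where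
  "u_in_p m v = (case v of U \<nu> i \<Rightarrow>
     Const (1 / of_nat m) * (\<Sum>\<beta><m. Const (inverse (xi m) ^ (\<beta> * \<nu>)) * Var (P \<beta> i)))"

text \<open>
  Both composites of the two substitutions fix the variables by Fourier inversion, hence all
  polynomials in them.
\<close>

lemma bij_betw_change_vars:
  assumes "m \<ge> 1"
  shows "bij_betw (change_vars m) (polys_in (p_vars m)) (polys_in (u_vars m))"
proof (rule bij_betw_byWitness[where f' = "psubst (u_in_p m)"])
  have "psubst (u_in_p m) (p_in_u m v) = Var v" if "v \<in> p_vars m" for v
  proof -
    obtain \<alpha> i where v: "v = P \<alpha> i" "\<alpha> < m" using \<open>v \<in> p_vars m\<close> by (auto simp: p_vars_def)
    have "psubst (u_in_p m) (p_in_u m v) = dft m (\<lambda>\<nu>. u_in_p m (U \<nu> i)) \<alpha>"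
      by (simp add: v p_in_u_P dft_def psubst_sum psubst_mult)
    then show ?thesis
      using dft_of_inverse[OF \<open>\<alpha> < m\<close>, of "\<lambda>\<beta>. Var (P \<beta> i)"] by (simp add: u_in_p_def v)
  qed
  then show "\<forall>f\<in>polys_in (p_vars m). psubst (u_in_p m) (change_vars m f) = f"
    by (simp add: change_vars_def psubst_psubst_id)
  have "psubst (p_in_u m) (u_in_p m v) = Var v" if "v \<in> u_vars m" for v
  proof -
    obtain \<nu> i where v: "v = U \<nu> i" "\<nu> < m" using \<open>v \<in> u_vars m\<close> by (auto simp: u_vars_def)
    have "psubst (p_in_u m) (u_in_p m v) = Const (1 / of_nat m) *
        (\<Sum>\<beta><m. Const (inverse (xi m) ^ (\<beta> * \<nu>)) * dft m (\<lambda>\<nu>. Var (U \<nu> i)) \<beta>)"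
      by (simp add: v u_in_p_def psubst_sum psubst_mult p_in_u_P)
    also have "\<dots> = Const (1 / of_nat m * of_nat m) * Var v"
      by (simp only: dft_inverse[OF \<open>\<nu> < m\<close>] of_nat_eq_Const Const_mult v mult.assoc)
    finally show ?thesis using assms by simp
  qed
  then show "\<forall>g\<in>polys_in (u_vars m). change_vars m (psubst (u_in_p m) g) = g"
    by (simp add: change_vars_def psubst_psubst_id)
  show "change_vars m ` polys_in (p_vars m) \<subseteq> polys_in (u_vars m)"
    unfolding change_vars_def
    by (auto simp: p_vars_def p_in_u_def u_vars_def intro!: psubst_in_polys_in
        sum_in_polys_in mult_in_polys_in Const_in_polys_in Var_in_polys_in)
  show "psubst (u_in_p m) ` polys_in (u_vars m) \<subseteq> polys_in (p_vars m)"
    by (auto simp: p_vars_def u_in_p_def u_vars_def intro!: psubst_in_polys_in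
        sum_in_polys_in mult_in_polys_in Const_in_polys_in Var_in_polys_in)
qed

text \<open>
  Among the images of the variables \<open>p\<close>, only those with lower index \<open>i\<close> contain \<open>U \<nu> i\<close>, with
  coefficient \<open>\<xi>\<^sup>\<alpha>\<^sup>\<nu>\<close>; so the chain rule is again a Fourier transform.
\<close>

lemma pdiff_change_vars:
  assumes "f \<in> polys_in (p_vars m)" "\<nu> < m" "i \<ge> 1"
  shows "pdiff (U \<nu> i) (change_vars m f) = dft m (\<lambda>\<alpha>. change_vars m (pdiff (P \<alpha> i) f)) \<nu>"
proof -
  have D: "pdiff (U \<nu> i) (p_in_u m (P \<alpha> j)) = (if j = i then Const (xi m ^ (\<nu> * \<alpha>)) else 0)" for \<alpha> j
  proof -
    have "pdiff (U \<nu> i) (p_in_u m (P \<alpha> j))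
        = (\<Sum>\<mu><m. if \<mu> = \<nu> then if j = i then Const (xi m ^ (\<nu> * \<alpha>)) else 0 else 0)"
      unfolding p_in_u_def pvar.case pdiff_sum pdiff_Const_mult
      by (intro sum.cong) (auto simp: pdiff_Var mult.commute)
    then show ?thesis using assms by simp
  qed
  have "pdiff (U \<nu> i) (change_vars m f)
      = (\<Sum>v\<in>(\<lambda>\<alpha>. P \<alpha> i) ` {..<m}. pdiff (U \<nu> i) (p_in_u m v) * change_vars m (pdiff v f))"
    unfolding change_vars_def
  proof (rule pdiff_psubst[OF assms(1)])
    show "pdiff (U \<nu> i) (p_in_u m v) = 0" if "v \<in> p_vars m - (\<lambda>\<alpha>. P \<alpha> i) ` {..<m}" for v
      using that by (auto simp: p_vars_def D)
  qed (use assms(3) in \<open>auto simp: p_vars_def\<close>)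
  also have "\<dots> = dft m (\<lambda>\<alpha>. change_vars m (pdiff (P \<alpha> i) f)) \<nu>"
    by (subst sum.reindex) (auto simp: inj_on_def D dft_def)
  finally show ?thesis .
qed

lemma pdiff_dft: "pdiff v (dft m a \<alpha>) = dft m (\<lambda>\<nu>. pdiff v (a \<nu>)) \<alpha>"
  by (simp add: dft_def pdiff_sum pdiff_Const_mult)

lemma pdiff_pdiff_change_vars:
  assumes "f \<in> polys_in (p_vars m)" "\<nu> < m" "i \<ge> 1" "j \<ge> 1"
  shows "pdiff (U \<nu> i) (pdiff (U \<nu> j) (change_vars m f))
       = dft m (\<lambda>\<gamma>. dft m (\<lambda>\<alpha>. change_vars m (pdiff (P \<alpha> i) (pdiff (P \<gamma> j) f))) \<nu>) \<nu>"
  using assms by (simp add: pdiff_change_vars pdiff_dft pdiff_in_polys_in)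


section \<open>Cut-and-join operators\<close>

lemma sum'_eq_sum:
  assumes "finite S" "S \<subseteq> A" "\<And>x. x \<in> A - S \<Longrightarrow> g x = 0"
  shows "sum' g A = sum g S"
proof -
  have "sum' g A = sum' g S"
    using assms by (intro sum.mono_neutral_right') auto
  also have "\<dots> = sum g S" using assms(1) by (rule sum.eq_sum)
  finally show ?thesis .
qed

lemma change_vars_CJ0_term:
  assumes "m \<ge> 1" "f \<in> polys_in (p_vars m)" "i \<ge> 1" "j \<ge> 1"
  shows "(\<Sum>\<alpha><m. \<Sum>\<gamma><m. change_vars m (CJ0_term m f ((i, j), \<alpha>, \<gamma>)))
       = of_nat m * (\<Sum>\<nu><m. CJq_term (U \<nu>) (change_vars m f) (i, j))"
proof -
  let ?T = "change_vars m" and ?u = "\<lambda>i \<nu>. Var (U \<nu> i)"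
  let ?D = "\<lambda>\<beta>. ?T (pdiff (P \<beta> (i + j)) f)"
  let ?DD = "\<lambda>\<alpha> \<gamma>. ?T (pdiff (P \<alpha> i) (pdiff (P \<gamma> j) f))"
  have "?T (CJ0_term m f ((i, j), \<alpha>, \<gamma>))
      = of_nat (i + j) * (dft m (?u i) \<alpha> * dft m (?u j) \<gamma> * ?D ((\<alpha> + \<gamma>) mod m))
      + of_nat (m * i * j) * (dft m (?u (i + j)) ((\<alpha> + \<gamma>) mod m) * ?DD \<alpha> \<gamma>)" for \<alpha> \<gamma>
    by (simp add: CJ0_term_def change_vars_def psubst_add psubst_mult p_in_u_P mult.assoc
        del: of_nat_add of_nat_mult)
  then have "(\<Sum>\<alpha><m. \<Sum>\<gamma><m. ?T (CJ0_term m f ((i, j), \<alpha>, \<gamma>)))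
      = of_nat (i + j) * (\<Sum>\<alpha><m. \<Sum>\<gamma><m. dft m (?u i) \<alpha> * dft m (?u j) \<gamma> * ?D ((\<alpha> + \<gamma>) mod m))
      + of_nat (m * i * j) * (\<Sum>\<alpha><m. \<Sum>\<gamma><m. dft m (?u (i + j)) ((\<alpha> + \<gamma>) mod m) * ?DD \<alpha> \<gamma>)"
    by (simp only: sum.distrib sum_distrib_left)
  also have "\<dots> = of_nat (i + j) * (of_nat m * (\<Sum>\<nu><m. ?u i \<nu> * ?u j \<nu> * dft m ?D \<nu>))
      + of_nat (m * i * j) * (\<Sum>\<nu><m. ?u (i + j) \<nu> * dft m (\<lambda>\<gamma>. dft m (\<lambda>\<alpha>. ?DD \<alpha> \<gamma>) \<nu>) \<nu>)"
    by (simp only: dft_cut[OF assms(1), where d = ?D] dft_join[OF assms(1)])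
  also have "\<dots> = of_nat m * (\<Sum>\<nu><m. of_nat (i * j) * ?u (i + j) \<nu> * dft m (\<lambda>\<gamma>. dft m (\<lambda>\<alpha>. ?DD \<alpha> \<gamma>) \<nu>) \<nu>
      + of_nat (i + j) * ?u i \<nu> * ?u j \<nu> * dft m ?D \<nu>)"
    by (simp add: sum.distrib sum_distrib_left mult_ac distrib_left del: of_nat_add)
  also have "\<dots> = of_nat m * (\<Sum>\<nu><m. CJq_term (U \<nu>) (?T f) (i, j))"
    using assms
    by (intro arg_cong[where f = "(*) _"] sum.cong)
       (simp_all add: CJq_term_def pdiff_pdiff_change_vars, simp add: pdiff_change_vars)
  finally show ?thesis .
qed

text \<open>
  The two sides are infinite sums with different supports. All of them may be taken over one finite
  set \<open>S\<close> of pairs \<open>(i, j)\<close> that contains both supports, and then they agree pair by pair.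
\<close>

lemma change_vars_CJ0:
  assumes "m \<ge> 1" "f \<in> polys_in (p_vars m)"
  shows "change_vars m (CJ0 m f) = of_nat m * (\<Sum>\<nu><m. CJq (U \<nu>) (change_vars m f))"
proof -
  let ?T = "change_vars m"
  let ?S0 = "fst ` {x \<in> ({1..} \<times> {1..}) \<times> ({..<m} \<times> {..<m}). CJ0_term m f x \<noteq> 0}"
  let ?S1 = "\<Union>\<nu><m. {x \<in> {1..} \<times> {1..}. CJq_term (U \<nu>) (?T f) x \<noteq> 0}"
  define S where "S = ?S0 \<union> ?S1"
  have fin: "finite S"
    unfolding S_def
    by (intro finite_UnI finite_imageI finite_UN_I CJ0_finite_support CJq_finite_support)
       (auto simp: inj_on_def)
  have sub: "S \<subseteq> {1..} \<times> {1..}" by (auto simp: S_def)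
  have sum0: "sum' (CJ0_term m f) (({1..} \<times> {1..}) \<times> ({..<m} \<times> {..<m}))
      = sum (CJ0_term m f) (S \<times> ({..<m} \<times> {..<m}))"
  proof (rule sum'_eq_sum)
    fix x assume x: "x \<in> ({1..} \<times> {1..}) \<times> ({..<m} \<times> {..<m}) - S \<times> ({..<m} \<times> {..<m})"
    then have "fst x \<notin> S" by (auto simp: mem_Times_iff)
    then have "fst x \<notin> ?S0" unfolding S_def by blast
    with x show "CJ0_term m f x = 0" by blast
  qed (use fin sub in auto)
  have sumq: "CJq (U \<nu>) (?T f) = Const (1/2) * sum (CJq_term (U \<nu>) (?T f)) S" if "\<nu> < m" for \<nu>
    unfolding CJq_def using that fin sub
    by (intro arg_cong[where f = "(*) _"] sum'_eq_sum) (auto simp: S_def)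
  have "?T (CJ0 m f)
      = Const (1/2) * (\<Sum>x\<in>S. \<Sum>\<alpha><m. \<Sum>\<gamma><m. ?T (CJ0_term m f (x, \<alpha>, \<gamma>)))"
    unfolding CJ0_def sum0
    by (simp add: change_vars_def psubst_mult psubst_sum sum.cartesian_product)
  also have "\<dots> = Const (1/2) * (\<Sum>x\<in>S. of_nat m * (\<Sum>\<nu><m. CJq_term (U \<nu>) (?T f) x))"
    using sub change_vars_CJ0_term[OF assms]
    by (intro arg_cong[where f = "(*) _"] sum.cong) auto
  also have "\<dots> = of_nat m * (\<Sum>\<nu><m. Const (1/2) * sum (CJq_term (U \<nu>) (?T f)) S)"
    by (subst (2) sum_distrib_left[symmetric], subst sum.swap)
       (simp add: sum_distrib_left mult_ac)
  finally show ?thesis by (simp add: sumq)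
qed

lemma change_vars_CJk_term:
  assumes "m \<ge> 1" "f \<in> polys_in (p_vars m)" "i \<ge> 1"
  shows "(\<Sum>\<alpha><m. change_vars m (CJk_term m k f (i, \<alpha>)))
       = (\<Sum>\<nu><m. Const (xi m ^ (k * \<nu>)) * E_op_term (U \<nu>) (change_vars m f) i)"
proof -
  let ?T = "change_vars m"
  have "(\<Sum>\<alpha><m. ?T (CJk_term m k f (i, \<alpha>)))
      = of_nat i * (\<Sum>\<alpha><m. dft m (\<lambda>\<nu>. Const (xi m ^ (k * \<nu>)) * Var (U \<nu> i)) \<alpha> * ?T (pdiff (P \<alpha> i) f))"
    by (simp add: CJk_term_def change_vars_def psubst_mult p_in_u_P dft_add_index[OF assms(1)]
        sum_distrib_left mult.assoc)
  also have "\<dots> = (\<Sum>\<nu><m. Const (xi m ^ (k * \<nu>)) * E_op_term (U \<nu>) (?T f) i)"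
    unfolding sum_dft_mult using assms
    by (simp add: sum_distrib_left E_op_term_def pdiff_change_vars mult_ac)
  finally show ?thesis .
qed

lemma change_vars_CJk:
  assumes "m \<ge> 1" "f \<in> polys_in (p_vars m)"
  shows "change_vars m (CJk m k f)
       = (\<Sum>\<alpha><m. Const (xi m ^ (k * \<alpha>)) * E_op (U \<alpha>) (change_vars m f))"
proof -
  let ?T = "change_vars m"
  let ?S0 = "fst ` {x \<in> {1..} \<times> {..<m}. CJk_term m k f x \<noteq> 0}"
  let ?S1 = "\<Union>\<nu><m. {i \<in> {1..}. E_op_term (U \<nu>) (?T f) i \<noteq> 0}"
  define S where "S = ?S0 \<union> ?S1"
  have fin: "finite S"
    unfolding S_def
    by (intro finite_UnI finite_imageI finite_UN_I CJk_finite_support E_op_finite_support)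
       (auto simp: inj_on_def)
  have sub: "S \<subseteq> {1..}" by (auto simp: S_def)
  have sumk: "CJk m k f = sum (CJk_term m k f) (S \<times> {..<m})"
    unfolding CJk_def
  proof (rule sum'_eq_sum)
    fix x assume x: "x \<in> {1..} \<times> {..<m} - S \<times> {..<m}"
    then have "fst x \<notin> S" by (auto simp: mem_Times_iff)
    then have "fst x \<notin> ?S0" unfolding S_def by blast
    with x show "CJk_term m k f x = 0" by blast
  qed (use fin sub in auto)
  have sumE: "E_op (U \<nu>) (?T f) = sum (E_op_term (U \<nu>) (?T f)) S" if "\<nu> < m" for \<nu>
    unfolding E_op_def using that fin sub by (intro sum'_eq_sum) (auto simp: S_def)
  have "?T (CJk m k f) = (\<Sum>i\<in>S. \<Sum>\<alpha><m. ?T (CJk_term m k f (i, \<alpha>)))"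
    by (simp add: sumk change_vars_def psubst_sum sum.cartesian_product)
  also have "\<dots> = (\<Sum>i\<in>S. \<Sum>\<nu><m. Const (xi m ^ (k * \<nu>)) * E_op_term (U \<nu>) (?T f) i)"
  proof (rule sum.cong[OF refl])
    fix i assume "i \<in> S"
    then have "i \<ge> 1" using sub by auto
    then show "(\<Sum>\<alpha><m. ?T (CJk_term m k f (i, \<alpha>)))
        = (\<Sum>\<nu><m. Const (xi m ^ (k * \<nu>)) * E_op_term (U \<nu>) (?T f) i)"
      by (rule change_vars_CJk_term[OF assms])
  qed
  also have "\<dots> = (\<Sum>\<nu><m. Const (xi m ^ (k * \<nu>)) * sum (E_op_term (U \<nu>) (?T f)) S)"
    by (subst sum.swap) (simp add: sum_distrib_left)
  finally show ?thesis by (simp add: sumE)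
qed

theorem proposition3p6:
  fixes m :: nat
  assumes "m \<ge> 1"
  shows "bij_betw (change_vars m) (polys_in (p_vars m)) (polys_in (u_vars m))
    \<and> (\<forall>f\<in>polys_in (p_vars m).
          change_vars m (CJ0 m f) = of_nat m * (\<Sum>\<nu><m. CJq (U \<nu>) (change_vars m f)))
    \<and> (\<forall>k\<in>{1..<m}. \<forall>f\<in>polys_in (p_vars m).
          change_vars m (CJk m k f) = (\<Sum>\<alpha><m. Const (xi m ^ (k * \<alpha>)) * E_op (U \<alpha>) (change_vars m f)))"
  using bij_betw_change_vars[OF assms] change_vars_CJ0[OF assms] change_vars_CJk[OF assms] by blast

end
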